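(* Let $\big(\mathcal{A}=\bigoplus_{i\ge 0}\mathcal{A}^i,\cdot,[\,,]\big)$ be a Gerstenhaber algebra generated, as a super-commutative associative algebra, by $\mathcal{A}^0$ and $\mathcal{A}^1$. Let $D$ be a degree $-1$ linear operator on $\mathcal{A}^0\oplus\mathcal{A}^1$ satisfying $D(a^0\cdot a^1)=[a^0,a^1]+a^0\cdot Da^1$ for all $a^0\in\mathcal{A}^0$, $a^1\in\mathcal{A}^1$, and let $\widetilde D$ be its extension to $\mathcal{A}$, i.e. the degree $-1$ linear operator with $\widetilde D=D$ on $\mathcal{A}^0\oplus\mathcal{A}^1$ and $$\widetilde D(a\cdot b)=(-1)^{|a|}[a,b]+\widetilde D a\cdot b+(-1)^{|a|}a\cdot\widetilde D b\qquad\text{for all } a\in\mathcal{A}^{|a|},\ b\in\mathcal{A}^{|b|},\ |a|+|b|>1 .$$ Then $\widetilde D^2=0$ if and only if $$D[a,b]=[Da,b]+[a,Db]\qquad\text{for all } a,b\in\mathcal{A}^1 .$$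
   Context: A Gerstenhaber algebra is a triple $\big(\mathcal{A}=\bigoplus_{i\ge0}\mathcal{A}^i,\cdot,[\,,]\big)$ such that: (1) $\mathcal{A}$ is a graded vector space; (2) the degree-zero product $\cdot$ ($\mathcal{A}^i\cdot\mathcal{A}^j\subseteq\mathcal{A}^{i+j}$) is associative and super-commutative, $a\cdot b=(-1)^{|a||b|}b\cdot a$; (3) the degree $-1$ bracket ($[\mathcal{A}^i,\mathcal{A}^j]\subseteq\mathcal{A}^{i+j-1}$) is a super-Lie bracket: it is super-antisymmetric, $[a,b]=-(-1)^{(|a|-1)(|b|-1)}[b,a]$, it satisfies the super-Jacobi identity $$(-1)^{(|a|-1)(|c|-1)}[[a,b],c]+(-1)^{(|b|-1)(|a|-1)}[[b,c],a]+(-1)^{(|c|-1)(|b|-1)}[[c,a],b]=0,$$ and the super-Leibniz identity $[a,b\cdot c]=[a,b]\cdot c+(-1)^{(|a|-1)|b|}b\cdot[a,c]$. Here $a\in\mathcal{A}^{|a|}$, $b\in\mathcal{A}^{|b|}$, $c\in\mathcal{A}^{|c|}$ are homogeneous. All operators are linear. An operator has degree $-1$ if it sends degree $i$ elements to degree $i-1$ elements, with $\mathcal{A}^{-1}=0$; so a degree $-1$ operator on $\mathcal{A}^0\oplus\mathcal{A}^1$ vanishes on $\mathcal{A}^0$ and maps $\mathcal{A}^1$ to $\mathcal{A}^0$. A Gerstenhaber generator is a degree $-1$ operator $D$ on $\mathcal{A}$ with $[a,b]=(-1)^{|a|}\big(D(a\cdot b)-Da\cdot b-(-1)^{|a|}a\cdot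 Db\big)$ for all $a\in\mathcal{A}^{|a|}$, $b\in\mathcal{A}$. Thus the operator $\widetilde D$ above is a Gerstenhaber generator. A Gerstenhaber generator of square zero is called a BV-generator. *)

theory Defs
  imports Complex_Main
begin

text \<open>
  The underlying space of the algebra is a type carrying a vector space structure over an arbitrary
  field; the graded pieces are subspaces \<open>A i\<close> of it, indexed by natural numbers.
  The associative product is the multiplication of the class \<open>ring\<close>, which has no unit.
\<close>

definition internal_direct_sum :: "(nat \<Rightarrow> 'a::comm_monoid_add set) \<Rightarrow> bool" where
  "internal_direct_sum A \<longleftrightarrow>
     (\<forall>x. \<exists>!f. (\<forall>i. f i \<in> A i) \<and> finite {i. f i \<noteq> 0} \<and> x = (\<Sum>i | f i \<noteq> 0. f i))"

text \<open>Integer degrees are needed only to make sense of degrees lowered below zero.\<close>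

definition piece :: "(nat \<Rightarrow> 'a::zero set) \<Rightarrow> int \<Rightarrow> 'a set" where
  "piece A n = (if n < 0 then {0} else A (nat n))"

locale graded_vector_space = vector_space scale
  for scale :: "'k::field \<Rightarrow> 'a::ab_group_add \<Rightarrow> 'a"  (infixr \<open>*s\<close> 75) +
  fixes A :: "nat \<Rightarrow> 'a set"
  assumes subspace_A: "subspace (A i)"
    and direct_sum: "internal_direct_sum A"

locale gerstenhaber_algebra = graded_vector_space scale A
  for scale :: "'k::field \<Rightarrow> 'a::ring \<Rightarrow> 'a"  (infixr \<open>*s\<close> 75)
    and A :: "nat \<Rightarrow> 'a set" +
  fixes br :: "'a \<Rightarrow> 'a \<Rightarrow> 'a"
  assumes scale_mult_left: "(r *s a) * b = r *s (a * b)"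
    and scale_mult_right: "a * (r *s b) = r *s (a * b)"
    and mult_degree: "\<lbrakk>a \<in> A i; b \<in> A j\<rbrakk> \<Longrightarrow> a * b \<in> A (i + j)"
    and super_commute: "\<lbrakk>a \<in> A i; b \<in> A j\<rbrakk> \<Longrightarrow> a * b = (-1) ^ (i * j) *s (b * a)"
    and linear_br_left: "Vector_Spaces.linear scale scale (\<lambda>a. br a b)"
    and linear_br_right: "Vector_Spaces.linear scale scale (\<lambda>b. br a b)"
    and br_degree: "\<lbrakk>a \<in> A i; b \<in> A j\<rbrakk> \<Longrightarrow> br a b \<in> piece A (int i + int j - 1)"
    and super_antisym: "\<lbrakk>a \<in> A i; b \<in> A j\<rbrakk> \<Longrightarrow>
          br a b = - ((-1) powi ((int i - 1) * (int j - 1)) *s br b a)"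
    and super_Jacobi: "\<lbrakk>a \<in> A i; b \<in> A j; c \<in> A k\<rbrakk> \<Longrightarrow>
          (-1) powi ((int i - 1) * (int k - 1)) *s br (br a b) c
        + (-1) powi ((int j - 1) * (int i - 1)) *s br (br b c) a
        + (-1) powi ((int k - 1) * (int j - 1)) *s br (br c a) b = 0"
    and super_Leibniz: "\<lbrakk>a \<in> A i; b \<in> A j; c \<in> A k\<rbrakk> \<Longrightarrow>
          br a (b * c) = br a b * c + (-1) powi ((int i - 1) * int j) *s (b * br a c)"

definition subalgebra :: "('k::field \<Rightarrow> 'a::ring \<Rightarrow> 'a) \<Rightarrow> 'a set \<Rightarrow> bool" where
  "subalgebra scale S \<longleftrightarrow> module.subspace scale S \<and> (\<forall>x\<in>S. \<forall>y\<in>S. x * y \<in> S)"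

definition generates_algebra :: "('k::field \<Rightarrow> 'a::ring \<Rightarrow> 'a) \<Rightarrow> 'a set \<Rightarrow> bool" where
  "generates_algebra scale X \<longleftrightarrow> subalgebra scale hull X = UNIV"

definition deg01 :: "(nat \<Rightarrow> 'a::plus set) \<Rightarrow> 'a set" where
  "deg01 A = {x + y | x y. x \<in> A 0 \<and> y \<in> A 1}"

definition linear_op_on :: "('k \<Rightarrow> 'a::plus \<Rightarrow> 'a) \<Rightarrow> 'a set \<Rightarrow> ('a \<Rightarrow> 'a) \<Rightarrow> bool" where
  "linear_op_on scale S f \<longleftrightarrow>
     (\<forall>x\<in>S. \<forall>y\<in>S. f (x + y) = f x + f y) \<and> (\<forall>c. \<forall>x\<in>S. f (scale c x) = scale c (f x))"

text \<open>The set \<open>I\<close> collects the degrees on which the operator is defined.\<close>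

definition degree_minus_one_on :: "(nat \<Rightarrow> 'a::zero set) \<Rightarrow> nat set \<Rightarrow> ('a \<Rightarrow> 'a) \<Rightarrow> bool" where
  "degree_minus_one_on A I f \<longleftrightarrow> (\<forall>i\<in>I. \<forall>a\<in>A i. f a \<in> piece A (int i - 1))"

text \<open>
  The values of \<open>D\<close> outside \<open>deg01 A\<close> are irrelevant. The product rule is required
  only in total degree greater than one; in degree at most one the extension is prescribed by \<open>D\<close>.
\<close>

definition is_extension ::
  "('k::field \<Rightarrow> 'a::ring \<Rightarrow> 'a) \<Rightarrow> (nat \<Rightarrow> 'a set) \<Rightarrow> ('a \<Rightarrow> 'a \<Rightarrow> 'a) \<Rightarrow>
    ('a \<Rightarrow> 'a) \<Rightarrow> ('a \<Rightarrow> 'a) \<Rightarrow> bool" where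
  "is_extension scale A br D E \<longleftrightarrow>
     Vector_Spaces.linear scale scale E \<and>
     degree_minus_one_on A UNIV E \<and>
     (\<forall>x\<in>deg01 A. E x = D x) \<and>
     (\<forall>i j. \<forall>a\<in>A i. \<forall>b\<in>A j. i + j > 1 \<longrightarrow>
        E (a * b) = scale ((-1) ^ i) (br a b) + E a * b + scale ((-1) ^ i) (a * E b))"

end

theory Submission
  imports Defs
begin

text \<open>
  Write \<open>E\<close> for the extension and \<open>\<Delta>(a, b) = E[a, b] - [Ea, b] + (-1)\<^sup>i [a, Eb]\<close>, with \<open>a\<close> of
  degree \<open>i\<close>, for the failure of \<open>E\<close> to be a derivation of the bracket. Two identities carry the
  proof. Applying the product rule of \<open>E\<close> twice gives, in \<open>square_mult\<close>,
  \<open>E\<^sup>2(ab) = E\<^sup>2a b + a E\<^sup>2b + (-1)\<^sup>i \<Delta>(a, b)\<close>, because the two terms \<open>Ea Eb\<close> cancel. So if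
  \<open>E\<^sup>2 = 0\<close>, then \<open>\<Delta>\<close> vanishes, in particular on \<open>A 1\<close>.

  Conversely, \<open>\<Delta>(a, -)\<close> is a graded derivation of the product (\<open>bracket_defect_mult\<close>): the double
  brackets created by the product rule cancel by the Jacobi identity. On two generators of degrees
  0 or 1, not both 1, \<open>\<Delta>\<close> vanishes since its value has negative degree, and on \<open>A 1\<close> it vanishes by
  hypothesis. Hence \<open>\<Delta>(g, w) = 0\<close> for a generator \<open>g\<close> and a word \<open>w\<close> in the generators. Since \<open>E\<^sup>2\<close>
  kills the generators for degree reasons, the first identity, applied letter by letter, shows that
  it kills every word, and the words span the algebra.
\<close>

section \<open>Integer degrees and Koszul signs\<close>

text \<open>
  This is multiplication by \<open>(-1)\<^sup>n\<close>. Written without scalars, every sign identity reduces to a case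
  distinction on parities followed by additive rearrangement, valid in any characteristic.
\<close>

definition koszul :: "int \<Rightarrow> 'a::ab_group_add \<Rightarrow> 'a" where
  "koszul n x = (if even n then x else - x)"

lemma zero_in_piece:
  assumes "\<And>i. 0 \<in> A i"
  shows "0 \<in> piece A n"
  using assms by (simp add: piece_def)

lemma in_piece_cases:
  assumes "a \<in> piece A n"
  obtains "a = 0" | m where "n = int m" "a \<in> A m"
  using assms by (cases "n < 0") (auto simp: piece_def intro: that(2)[of "nat n"])

lemma piece_int [simp]: "piece A (int n) = A n"
  by (simp add: piece_def)

context gerstenhaber_algebra
begin

lemma scale_powi: "(-1) powi n *s x = koszul n x"
  by (simp add: koszul_def power_int_minus_left)

lemma scale_power: "(-1) ^ n *s x = koszul (int n) x"
  by (simp add: koszul_def uminus_power_if)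

lemma zero_in_A: "0 \<in> A i"
  using subspace_A by (rule subspace_0)

lemma br_add:
  "br (x + y) z = br x z + br y z" "br z (x + y) = br z x + br z y"
  using linear_br_left[of z] linear_br_right[of z]
  by (auto simp: Vector_Spaces.linear_iff)

lemma br_zero [simp]: "br 0 z = 0" "br z 0 = 0"
  using br_add(1)[of 0 0 z] br_add(2)[of z 0 0] by simp_all

lemma br_minus [simp]: "br (- x) z = - br x z" "br z (- x) = - br z x"
  using br_add(1)[of x "- x" z] br_add(2)[of z x "- x"]
  by (simp_all add: eq_neg_iff_add_eq_0 add.commute)

lemma br_diff:
  "br (x - y) z = br x z - br y z" "br z (x - y) = br z x - br z y"
  using br_add(1)[of x "- y" z] br_add(2)[of z x "- y"] by simp_all

text \<open>
  The axioms extend to integer degrees, since elements of negative degree are zero. The product rule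
  can then be applied to \<open>Ea\<close> and \<open>[a, b]\<close> without asking whether their degrees are negative.
\<close>

lemma mult_in_piece:
  "\<lbrakk>a \<in> piece A m; b \<in> piece A n\<rbrakk> \<Longrightarrow> a * b \<in> piece A (m + n)"
  by (elim in_piece_cases)
    (auto simp: zero_in_piece zero_in_A mult_degree simp flip: of_nat_add)

lemma br_in_piece:
  "\<lbrakk>a \<in> piece A m; b \<in> piece A n\<rbrakk> \<Longrightarrow> br a b \<in> piece A (m + n - 1)"
  by (elim in_piece_cases) (auto simp: zero_in_piece zero_in_A br_degree)

lemma br_antisym:
  assumes "a \<in> piece A m" "b \<in> piece A n"
  shows "br a b = - koszul ((m - 1) * (n - 1)) (br b a)"
  using assms
proof (elim in_piece_cases)
  fix i j
  assume "m = int i" "n = int j" "a \<in> A i" "b \<in> A j"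
  then show ?thesis
    using super_antisym[of a i b j, unfolded scale_powi] by blast
qed (simp_all add: koszul_def)

lemma br_mult:
  assumes "a \<in> piece A m" "b \<in> piece A n" "c \<in> piece A p"
  shows "br a (b * c) = br a b * c + koszul ((m - 1) * n) (b * br a c)"
  using assms
  by (elim in_piece_cases)
    (auto simp: super_Leibniz[unfolded scale_powi] simp: koszul_def)

text \<open>
  Antisymmetry turns the cyclic Jacobi identity into the statement that bracketing with \<open>a\<close> is a
  derivation of the bracket; all signs depend only on the parities of the three degrees.
\<close>

lemma br_br:
  assumes a: "a \<in> piece A m" and b: "b \<in> piece A n" and c: "c \<in> piece A p"
  shows "br a (br b c) = br (br a b) c + koszul ((m - 1) * (n - 1)) (br b (br a c))"
proof -
  have J: "koszul ((m - 1) * (p - 1)) (br (br a b) c)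
      + koszul ((n - 1) * (m - 1)) (br (br b c) a)
      + koszul ((p - 1) * (n - 1)) (br (br c a) b) = 0"
    using assms
  proof (elim in_piece_cases)
    fix i j k
    assume "m = int i" "n = int j" "p = int k" "a \<in> A i" "b \<in> A j" "c \<in> A k"
    then show ?thesis
      using super_Jacobi[of a i b j c k, unfolded scale_powi] by blast
  qed (simp_all add: koszul_def)
  have bca: "br (br b c) a = - koszul ((n + p - 1 - 1) * (m - 1)) (br a (br b c))"
    by (rule br_antisym[OF br_in_piece[OF b c] a])
  have cab: "br (br c a) b = - koszul ((p + m - 1 - 1) * (n - 1)) (br b (br c a))"
    by (rule br_antisym[OF br_in_piece[OF c a] b])
  have ca: "br c a = - koszul ((p - 1) * (m - 1)) (br a c)"
    by (rule br_antisym[OF c a])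
  show ?thesis
    using J unfolding bca cab unfolding ca
    by (cases "even m"; cases "even n"; cases "even p")
      (simp_all add: koszul_def algebra_simps eq_neg_iff_add_eq_0 neg_eq_iff_add_eq_0)
qed

end

section \<open>The defect of a generator of the bracket\<close>

locale gerstenhaber_generator = gerstenhaber_algebra scale A br
  for scale :: "'k::field \<Rightarrow> 'a::ring \<Rightarrow> 'a"  (infixr \<open>*s\<close> 75)
    and A :: "nat \<Rightarrow> 'a set"
    and br :: "'a \<Rightarrow> 'a \<Rightarrow> 'a" +
  fixes E :: "'a \<Rightarrow> 'a"
  assumes linear_E: "Vector_Spaces.linear scale scale E"
    and E_in_A: "a \<in> A i \<Longrightarrow> E a \<in> piece A (int i - 1)"
    and E_mult_A: "\<lbrakk>a \<in> A i; b \<in> A j\<rbrakk> \<Longrightarrow>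
          E (a * b) = koszul (int i) (br a b) + E a * b + koszul (int i) (a * E b)"
begin

lemma E_add: "E (x + y) = E x + E y"
  and E_scale: "E (r *s x) = r *s E x"
  using linear_E by (auto simp: Vector_Spaces.linear_iff)

lemma E_zero [simp]: "E 0 = 0"
  using E_add[of 0 0] by simp

lemma E_minus [simp]: "E (- x) = - E x"
  using E_add[of x "- x"] by (simp add: eq_neg_iff_add_eq_0 add.commute)

lemma E_diff: "E (x - y) = E x - E y"
  using E_add[of x "- y"] by simp

lemma E_in_piece: "a \<in> piece A n \<Longrightarrow> E a \<in> piece A (n - 1)"
  by (elim in_piece_cases) (auto simp: zero_in_piece zero_in_A E_in_A)

lemma E_mult:
  "\<lbrakk>a \<in> piece A m; b \<in> piece A n\<rbrakk> \<Longrightarrow>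
     E (a * b) = koszul m (br a b) + E a * b + koszul m (a * E b)"
  by (elim in_piece_cases) (auto simp: koszul_def E_mult_A)

text \<open>
  The degree of the first argument is passed explicitly because zero is homogeneous of every degree.
\<close>

definition bracket_defect :: "int \<Rightarrow> 'a \<Rightarrow> 'a \<Rightarrow> 'a" where
  "bracket_defect m a b = E (br a b) - br (E a) b + koszul m (br a (E b))"

text \<open>The product rule for \<open>a Eb\<close> and for \<open>Ea b\<close> yields \<open>Ea Eb\<close> twice, with opposite signs.\<close>

lemma square_mult:
  assumes a: "a \<in> piece A m" and b: "b \<in> piece A n"
  shows "E (E (a * b)) = E (E a) * b + a * E (E b) + koszul m (bracket_defect m a b)"
  unfolding E_mult[OF a b] bracket_defect_def
  by (cases "even m")
    (simp_all add: koszul_def E_add E_diff E_mult[OF E_in_piece[OF a] b]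
      E_mult[OF a E_in_piece[OF b]] algebra_simps)

text \<open>
  The mixed terms \<open>[a, b] Ec\<close> and \<open>Eb [a, c]\<close> occur twice with opposite signs, and the double
  brackets \<open>[[a, b], c]\<close>, \<open>[b, [a, c]]\<close> and \<open>[a, [b, c]]\<close> add up to a multiple of the Jacobi identity.
\<close>

lemma bracket_defect_mult:
  assumes a: "a \<in> piece A m" and b: "b \<in> piece A n" and c: "c \<in> piece A p"
  shows "bracket_defect m a (b * c)
    = bracket_defect m a b * c + koszul (m * n) (b * bracket_defect m a c)"
  unfolding bracket_defect_def br_mult[OF a b c] br_mult[OF E_in_piece[OF a] b c] E_mult[OF b c]
  by (cases "even m"; cases "even n")
    (simp_all add: koszul_def E_add E_diff br_add br_diff
      E_mult[OF br_in_piece[OF a b] c] E_mult[OF b br_in_piece[OF a c]]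
      br_mult[OF a E_in_piece[OF b] c] br_mult[OF a b E_in_piece[OF c]]
      br_br[OF a b c] algebra_simps)

lemma bracket_defect_low_degree:
  assumes a: "a \<in> piece A m" and b: "b \<in> piece A n" and "m + n \<le> 1"
  shows "bracket_defect m a b = 0"
proof -
  have "E (br a b) = 0" "br (E a) b = 0" "br a (E b) = 0"
    using E_in_piece[OF br_in_piece[OF a b]] br_in_piece[OF E_in_piece[OF a] b]
      br_in_piece[OF a E_in_piece[OF b]] \<open>m + n \<le> 1\<close>
    by (simp_all add: piece_def)
  then show ?thesis
    by (simp add: bracket_defect_def koszul_def)
qed

end

section \<open>Words in the generators of degrees 0 and 1\<close>

text \<open>
  Words are built by adding one letter on the left, so that the two product identities are only ever
  needed with a single generator as the first factor.
\<close>

inductive word :: "(nat \<Rightarrow> 'a::ring set) \<Rightarrow> int \<Rightarrow> 'a \<Rightarrow> bool" for A where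
  letter: "\<lbrakk>g \<in> piece A m; m \<in> {0, 1}\<rbrakk> \<Longrightarrow> word A m g"
| cons: "\<lbrakk>g \<in> piece A m; m \<in> {0, 1}; word A n w\<rbrakk> \<Longrightarrow> word A (m + n) (g * w)"

context gerstenhaber_algebra
begin

lemma word_in_piece: "word A n w \<Longrightarrow> w \<in> piece A n"
  by (induction rule: word.induct) (auto intro: mult_in_piece)

lemma letter_mult_span_words:
  assumes g: "g \<in> piece A m" "m \<in> {0, 1}" and "y \<in> span {w. \<exists>n. word A n w}"
  shows "g * y \<in> span {w. \<exists>n. word A n w}"
  using assms(3)
proof (induction rule: span_induct_alt)
  case base
  show ?case by (simp add: span_zero)
next
  case (step c w y)
  then have "g * w \<in> span {w. \<exists>n. word A n w}"
    using g by (blast intro: span_base word.cons)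
  then show ?case
    using step by (simp add: distrib_left scale_mult_right span_add span_scale)
qed

lemma word_mult_span_words:
  assumes "word A n w" "y \<in> span {w. \<exists>n. word A n w}"
  shows "w * y \<in> span {w. \<exists>n. word A n w}"
  using assms
  by (induction rule: word.induct) (auto simp: mult.assoc intro!: letter_mult_span_words)

lemma subalgebra_span_words: "subalgebra scale (span {w. \<exists>n. word A n w})"
  unfolding subalgebra_def
proof (intro conjI ballI)
  show "subspace (span {w. \<exists>n. word A n w})"
    by (rule subspace_span)
next
  fix x y
  assume "x \<in> span {w. \<exists>n. word A n w}" and y: "y \<in> span {w. \<exists>n. word A n w}"
  then show "x * y \<in> span {w. \<exists>n. word A n w}"
  proof (induction rule: span_induct_alt)
    case base
    show ?case by (simp add: span_zero)
  next
    case (step c w x)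
    then show ?case
      using word_mult_span_words[OF _ y]
      by (auto simp: distrib_right scale_mult_left intro!: span_add span_scale)
  qed
qed

lemma span_words_UNIV:
  assumes "generates_algebra scale (A 0 \<union> A 1)"
  shows "span {w. \<exists>n. word A n w} = UNIV"
proof -
  have "A 0 \<union> A 1 \<subseteq> {w. \<exists>n. word A n w}"
    using word.letter[of _ A 0] word.letter[of _ A 1]
    by (fastforce simp: piece_def)
  also have "\<dots> \<subseteq> span {w. \<exists>n. word A n w}"
    by (rule span_superset)
  finally have "subalgebra scale hull (A 0 \<union> A 1) \<subseteq> span {w. \<exists>n. word A n w}"
    by (rule hull_minimal) (rule subalgebra_span_words)
  then show ?thesis
    using assms by (auto simp: generates_algebra_def)
qed

end

section \<open>The square of a generator of the bracket\<close>

context gerstenhaber_generator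
begin

lemma bracket_defect_letter_word:
  assumes defect: "\<And>a b. \<lbrakk>a \<in> A 1; b \<in> A 1\<rbrakk> \<Longrightarrow> bracket_defect 1 a b = 0"
    and g: "g \<in> piece A m" "m \<in> {0, 1}" and "word A n w"
  shows "bracket_defect m g w = 0"
proof -
  have letters: "bracket_defect m g h = 0" if h: "h \<in> piece A k" "k \<in> {0, 1}" for h k
  proof (cases "m = 1 \<and> k = 1")
    case True
    then show ?thesis
      using defect g h by (simp add: piece_def)
  next
    case False
    then show ?thesis
      using bracket_defect_low_degree[OF g(1) h(1)] g(2) h(2) by auto
  qed
  show ?thesis
    using \<open>word A n w\<close>
  proof (induction rule: word.induct)
    case (letter h k)
    then show ?case by (rule letters)
  next
    case (cons h k n w)
    then show ?case
      using bracket_defect_mult[OF g(1) cons.hyps(1) word_in_piece[OF cons.hyps(3)]]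
        letters[OF cons.hyps(1,2)]
      by (simp add: koszul_def)
  qed
qed

lemma square_letter:
  assumes "g \<in> piece A m" "m \<in> {0, 1}"
  shows "E (E g) = 0"
  using E_in_piece[OF E_in_piece[OF assms(1)]] assms(2) by (auto simp: piece_def)

lemma square_word:
  assumes defect: "\<And>a b. \<lbrakk>a \<in> A 1; b \<in> A 1\<rbrakk> \<Longrightarrow> bracket_defect 1 a b = 0"
    and "word A n w"
  shows "E (E w) = 0"
  using \<open>word A n w\<close>
proof (induction rule: word.induct)
  case (letter g m)
  then show ?case by (rule square_letter)
next
  case (cons g m n w)
  then show ?case
    using square_mult[OF cons.hyps(1) word_in_piece[OF cons.hyps(3)]]
      square_letter[OF cons.hyps(1,2)]
      bracket_defect_letter_word[OF defect cons.hyps]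
    by (simp add: koszul_def)
qed

lemma square_zero_iff:
  assumes "generates_algebra scale (A 0 \<union> A 1)"
  shows "(\<forall>x. E (E x) = 0) \<longleftrightarrow> (\<forall>a\<in>A 1. \<forall>b\<in>A 1. bracket_defect 1 a b = 0)"
proof (intro iffI ballI allI)
  fix a b
  assume "\<forall>x. E (E x) = 0" and "a \<in> A 1" "b \<in> A 1"
  then show "bracket_defect 1 a b = 0"
    using square_mult[of a 1 b 1] by (simp add: piece_def koszul_def)
next
  fix x
  assume defect: "\<forall>a\<in>A 1. \<forall>b\<in>A 1. bracket_defect 1 a b = 0"
  have "x \<in> span {w. \<exists>n. word A n w}"
    by (simp add: span_words_UNIV[OF assms])
  then show "E (E x) = 0"
  proof (induction rule: span_induct_alt)
    case base
    show ?case by simp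
  next
    case (step c w y)
    then show ?case
      using square_word defect by (auto simp: E_add E_scale)
  qed
qed

end

text \<open>
  In total degree at most one the product rule also holds: in degree one it is the hypothesis on
  \<open>D\<close>, up to commuting the factors, and in degree zero every term has negative degree.
\<close>

lemma extension_generates_bracket:
  fixes scale :: "'k::field \<Rightarrow> 'a::ring \<Rightarrow> 'a"
  assumes "gerstenhaber_algebra scale A br"
    and D: "\<And>a0 a1. a0 \<in> A 0 \<Longrightarrow> a1 \<in> A 1 \<Longrightarrow> D (a0 * a1) = br a0 a1 + a0 * D a1"
    and ext: "is_extension scale A br D E"
    and E_eq_D: "\<And>i x. \<lbrakk>x \<in> A i; i \<le> 1\<rbrakk> \<Longrightarrow> E x = D x"
  shows "gerstenhaber_generator scale A br E"
proof -
  interpret gerstenhaber_algebra scale A br by fact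
  have degree: "E a \<in> piece A (int i - 1)" if "a \<in> A i" for a i
    using ext that by (auto simp: is_extension_def degree_minus_one_on_def)
  have E0: "E a = 0" if "a \<in> A 0" for a
    using degree[OF that] by (simp add: piece_def)
  have E01: "E (a * b) = br a b + a * E b" if "a \<in> A 0" "b \<in> A 1" for a b
    using D[OF that] E_eq_D[OF mult_degree[OF that]] E_eq_D[OF that(2)] by simp
  have mult: "E (a * b) = koszul (int i) (br a b) + E a * b + koszul (int i) (a * E b)"
    if a: "a \<in> A i" and b: "b \<in> A j" for a b i j
  proof -
    consider "i + j > 1" | "i = 0" "j = 0" | "i = 0" "j = 1" | "i = 1" "j = 0"
      by linarith
    then show ?thesis
    proof cases
      case 1
      then show ?thesis
        using ext a b by (auto simp: is_extension_def scale_power)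
    next
      case 2
      then show ?thesis
        using a b E0 mult_degree[OF a b] br_degree[OF a b] by (simp add: koszul_def piece_def)
    next
      case 3
      then show ?thesis
        using a b E0 E01 by (simp add: koszul_def)
    next
      case 4
      have "E b = 0"
        using E0 b 4 by simp
      moreover have "E (a * b) = - br a b + E a * b"
      proof -
        have "a * b = b * a"
          using super_commute[OF a b] 4 by simp
        moreover have "b * E a = E a * b"
          using super_commute[of "E a" 0 b 0] degree[OF a] b 4 by (simp add: piece_def)
        moreover have "br b a = - br a b"
          using super_antisym[OF b a] 4 by simp
        moreover have "E (b * a) = br b a + b * E a"
          using E01 a b 4 by simp
        ultimately show ?thesis
          by metis
      qed
      ultimately show ?thesis
        using 4 by (simp add: koszul_def)
    qed
  qed
  have "Vector_Spaces.linear scale scale E"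
    using ext by (simp add: is_extension_def)
  then have "gerstenhaber_generator_axioms scale A br E"
    using degree mult by (rule gerstenhaber_generator_axioms.intro)
  with assms(1) show ?thesis
    by (rule gerstenhaber_generator.intro)
qed

theorem proposition2p2:
  fixes scale :: "'k::field \<Rightarrow> 'a::ring \<Rightarrow> 'a"
    and A :: "nat \<Rightarrow> 'a set"
    and br :: "'a \<Rightarrow> 'a \<Rightarrow> 'a"
    and D Dtilde :: "'a \<Rightarrow> 'a"
  assumes "gerstenhaber_algebra scale A br"
    and "generates_algebra scale (A 0 \<union> A 1)"
    and "linear_op_on scale (deg01 A) D"
    and "degree_minus_one_on A {0, 1} D"
    and "\<And>a0 a1. a0 \<in> A 0 \<Longrightarrow> a1 \<in> A 1 \<Longrightarrow> D (a0 * a1) = br a0 a1 + a0 * D a1"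
    and "is_extension scale A br D Dtilde"
  shows "(\<forall>x. Dtilde (Dtilde x) = 0) \<longleftrightarrow>
         (\<forall>a\<in>A 1. \<forall>b\<in>A 1. D (br a b) = br (D a) b + br a (D b))"
proof -
  interpret gerstenhaber_algebra scale A br by fact
  have Dtilde_eq_D: "Dtilde x = D x" if "x \<in> A i" "i \<le> 1" for i x
  proof -
    have "x \<in> deg01 A"
    proof (cases "i = 0")
      case True
      then show ?thesis
        using that zero_in_A[of 1] unfolding deg01_def by force
    next
      case False
      then have "i = 1"
        using that by simp
      then show ?thesis
        using that zero_in_A[of 0] unfolding deg01_def by force
    qed
    then show ?thesis
      using assms(6) by (simp add: is_extension_def)
  qed
  interpret gerstenhaber_generator scale A br Dtilde
    using assms(1,5,6) Dtilde_eq_D by (rule extension_generates_bracket)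
  have "bracket_defect 1 a b = 0 \<longleftrightarrow> D (br a b) = br (D a) b + br a (D b)"
    if "a \<in> A 1" "b \<in> A 1" for a b
  proof -
    have "br a b \<in> A 1"
      using br_degree[OF that] by (simp add: piece_def)
    then show ?thesis
      using that by (simp add: bracket_defect_def koszul_def Dtilde_eq_D[of _ 1] algebra_simps)
  qed
  then show ?thesis
    by (simp add: square_zero_iff[OF assms(2)])
qed

end
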